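(* \texttt{MPC-ARC} can be solved in polynomial time on DAGs that are transitive closures of paths.
   Context: Let $G=(V,A)$ be a DAG and $\check{A}\subseteq A$ a given subset of arcs. A path is feasible if it contains at least one arc of $\check{A}$. \texttt{MPC-ARC} asks for a minimum-cardinality set of node-disjoint paths covering all nodes of $G$ such that every path is feasible (or to report that none exists). The transitive closure of a path $(v_1,\ldots,v_n)$ is the DAG with node set $\{v_1,\ldots,v_n\}$ and arc set $\{(v_i,v_j):1\le i<j\le n\}$. *)

theory Defs
  imports
    "HOL-Computational_Algebra.Polynomial"
    "Graph_Theory.Graph_Theory"
begin

section \<open>Random access machines\<close>

text \<open>
  Polynomial time refers to structured programs for a random access machine with finitely many
  registers used by any one program, an unbounded memory with indirect addressing, and unit cost.
  Addition and truncated subtraction are the only arithmetic operations. A fixed program therefore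
  lengthens the binary representation of the largest number occurring by at most a constant per
  step, so that, up to polynomials, this unit cost agrees with the running time of Turing machines.
  (With multiplication under unit cost this would fail.)
\<close>

record ram_state =
  reg :: "nat \<Rightarrow> nat"
  mem :: "nat \<Rightarrow> nat"

datatype ram_expr =
    Const nat
  | Reg nat
  | Load ram_expr
  | Plus ram_expr ram_expr
  | Minus ram_expr ram_expr

primrec ram_val :: "ram_expr \<Rightarrow> ram_state \<Rightarrow> nat" where
  "ram_val (Const k) s = k"
| "ram_val (Reg r) s = reg s r"
| "ram_val (Load e) s = mem s (ram_val e s)"
| "ram_val (Plus e f) s = ram_val e s + ram_val f s"
| "ram_val (Minus e f) s = ram_val e s - ram_val f s"

datatype ram_prog =
    Skip
  | Assign nat ram_expr
  | Store ram_expr ram_expr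
  | Seq ram_prog ram_prog
  | If ram_expr ram_prog ram_prog
  | While ram_expr ram_prog

text \<open>
  \<open>ram_exec c s t s'\<close>: started in state \<open>s\<close>, program \<open>c\<close> halts in state \<open>s'\<close> after \<open>t\<close> steps.
  A test succeeds iff the value is nonzero. The size of the expressions in a program does not
  depend on the input, so evaluating one counts as a single step.
\<close>

inductive ram_exec :: "ram_prog \<Rightarrow> ram_state \<Rightarrow> nat \<Rightarrow> ram_state \<Rightarrow> bool" where
  Skip: "ram_exec Skip s 1 s"
| Assign: "ram_exec (Assign r e) s 1 (s\<lparr>reg := (reg s)(r := ram_val e s)\<rparr>)"
| Store: "ram_exec (Store a e) s 1 (s\<lparr>mem := (mem s)(ram_val a s := ram_val e s)\<rparr>)"
| Seq: "ram_exec c s t s' \<Longrightarrow> ram_exec d s' u s'' \<Longrightarrow> ram_exec (Seq c d) s (t + u) s''"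
| IfTrue: "ram_val e s \<noteq> 0 \<Longrightarrow> ram_exec c s t s' \<Longrightarrow> ram_exec (If e c d) s (1 + t) s'"
| IfFalse: "ram_val e s = 0 \<Longrightarrow> ram_exec d s t s' \<Longrightarrow> ram_exec (If e c d) s (1 + t) s'"
| WhileTrue: "ram_val e s \<noteq> 0 \<Longrightarrow> ram_exec c s t s' \<Longrightarrow> ram_exec (While e c) s' u s''
    \<Longrightarrow> ram_exec (While e c) s (1 + t + u) s''"
| WhileFalse: "ram_val e s = 0 \<Longrightarrow> ram_exec (While e c) s 1 s"

inductive_cases SkipE: "ram_exec Skip s t s'"
inductive_cases AssignE: "ram_exec (Assign r e) s t s'"
inductive_cases StoreE: "ram_exec (Store a e) s t s'"
inductive_cases SeqE: "ram_exec (Seq c d) s t s'"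
inductive_cases IfE: "ram_exec (If e c d) s t s'"
inductive_cases WhileE: "ram_exec (While e c) s t s'"

lemma ram_exec_deterministic:
  "ram_exec c s t s' \<Longrightarrow> ram_exec c s u s'' \<Longrightarrow> u = t \<and> s'' = s'"
proof (induction arbitrary: u s'' rule: ram_exec.induct)
  case (Skip s)
  then show ?case by (auto elim: SkipE)
next
  case (Assign r e s)
  then show ?case by (auto elim: AssignE)
next
  case (Store a e s)
  then show ?case by (auto elim: StoreE)
next
  case (Seq c s t s' d u s'' v r)
  from Seq.prems obtain t1 s1 u1 where
    *: "v = t1 + u1" "ram_exec c s t1 s1" "ram_exec d s1 u1 r" by (rule SeqE)
  from Seq.IH(1)[OF *(2)] have "t1 = t" "s1 = s'" by simp_all
  with Seq.IH(2)[of u1 r] * show ?case by simp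
next
  case (IfTrue e s c t s' d v r)
  from IfTrue.prems show ?case
  proof (rule IfE)
    fix t1 assume "v = Suc t1" "ram_exec c s t1 r"
    with IfTrue.IH[of t1 r] show ?thesis by simp
  qed (use IfTrue.hyps in simp)
next
  case (IfFalse e s d t s' c v r)
  from IfFalse.prems show ?case
  proof (rule IfE)
    fix t1 assume "v = Suc t1" "ram_exec d s t1 r"
    with IfFalse.IH[of t1 r] show ?thesis by simp
  qed (use IfFalse.hyps in simp)
next
  case (WhileTrue e s c t s' u s'' v r)
  from WhileTrue.prems show ?case
  proof (rule WhileE)
    fix t1 s1 u1
    assume *: "v = Suc (t1 + u1)" "ram_exec c s t1 s1" "ram_exec (While e c) s1 u1 r"
    from WhileTrue.IH(1)[OF *(2)] have "t1 = t" "s1 = s'" by simp_all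
    with WhileTrue.IH(2)[of u1 r] * show ?thesis by simp
  qed (use WhileTrue.hyps in simp)
next
  case (WhileFalse e s c v r)
  from WhileFalse.prems show ?case
    by (rule WhileE) (use WhileFalse.hyps in simp_all)
qed

text \<open>Input and output are lists of numbers, with the length in register 0 and the entries in memory.\<close>

definition ram_input :: "nat list \<Rightarrow> ram_state" where
  "ram_input xs = \<lparr>reg = (\<lambda>r. if r = 0 then length xs else 0),
                   mem = (\<lambda>a. if a < length xs then xs ! a else 0)\<rparr>"

definition ram_output :: "ram_state \<Rightarrow> nat list" where
  "ram_output s = map (mem s) [0..<reg s 0]"

text \<open>
  A search problem is given by the relation \<open>sol\<close> between instances and correct answers.
  Nothing is required of the program on inputs that do not encode an instance in \<open>I\<close>.
\<close>

definition solvable_in_polynomial_time_on ::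
  "'i set \<Rightarrow> ('i \<Rightarrow> nat list) \<Rightarrow> ('o \<Rightarrow> nat list) \<Rightarrow> ('i \<Rightarrow> 'o \<Rightarrow> bool) \<Rightarrow> bool" where
  "solvable_in_polynomial_time_on I enc_in enc_out sol \<longleftrightarrow>
     (\<exists>(c :: ram_prog) (p :: nat poly). \<forall>x\<in>I. \<exists>t s y.
        ram_exec c (ram_input (enc_in x)) t s \<and>
        t \<le> poly p (length (enc_in x)) \<and>
        ram_output s = enc_out y \<and> sol x y)"


section \<open>Minimum path covers with arc constraints\<close>

type_synonym 'a mpc_arc = "'a pair_pre_digraph \<times> 'a rel"

definition mpc_arc_instance :: "'a mpc_arc \<Rightarrow> bool" where
  "mpc_arc_instance = (\<lambda>(G, C). pair_fin_digraph G \<and> acyclic (parcs G) \<and> C \<subseteq> parcs G)"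

definition feasible_path :: "'a mpc_arc \<Rightarrow> 'a list \<Rightarrow> bool" where
  "feasible_path = (\<lambda>(G, C) p. vpath p (with_proj G) \<and> set (vwalk_arcs p) \<inter> C \<noteq> {})"

definition feasible_path_cover :: "'a mpc_arc \<Rightarrow> 'a list set \<Rightarrow> bool" where
  "feasible_path_cover = (\<lambda>(G, C) P.
     finite P \<and> (\<forall>p\<in>P. feasible_path (G, C) p) \<and>
     pairwise (\<lambda>p q. disjnt (set p) (set q)) P \<and>
     (\<Union>p\<in>P. set p) = pverts G)"

text \<open>The answer \<open>None\<close> reports that there is no feasible path cover.\<close>

primrec mpc_arc_solution :: "'a mpc_arc \<Rightarrow> 'a list list option \<Rightarrow> bool" where
  "mpc_arc_solution x None \<longleftrightarrow> (\<nexists>P. feasible_path_cover x P)"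
| "mpc_arc_solution x (Some ps) \<longleftrightarrow>
     distinct ps \<and> is_arg_min card (feasible_path_cover x) (set ps)"

definition path_closure :: "'a list \<Rightarrow> 'a pair_pre_digraph" where
  "path_closure vs =
     \<lparr>pverts = set vs, parcs = {(vs ! i, vs ! j) | i j. i < j \<and> j < length vs}\<rparr>"

definition is_path_closure :: "'a pair_pre_digraph \<Rightarrow> bool" where
  "is_path_closure G \<longleftrightarrow> (\<exists>vs. vs \<noteq> [] \<and> distinct vs \<and> G = path_closure vs)"


section \<open>Encodings\<close>

text \<open>
  Instances to be encoded have the nodes \<open>0, ..., n - 1\<close>, in an order unrelated to the arcs.
  They are given by \<open>n\<close> followed by two adjacency matrices, row by row. The length of the
  encoding is \<open>1 + 2 n\<^sup>2\<close> and all entries are at most \<open>max 1 n\<close>, so that this length is, up to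
  polynomials, the number of bits.
\<close>

definition standard_nodes :: "nat pair_pre_digraph \<Rightarrow> bool" where
  "standard_nodes G \<longleftrightarrow> pverts G = {..<card (pverts G)}"

definition adjacency_code :: "nat \<Rightarrow> nat rel \<Rightarrow> nat list" where
  "adjacency_code n R = concat (map (\<lambda>u. map (\<lambda>v. if (u, v) \<in> R then 1 else 0) [0..<n]) [0..<n])"

definition mpc_arc_code :: "nat mpc_arc \<Rightarrow> nat list" where
  "mpc_arc_code = (\<lambda>(G, C). let n = card (pverts G) in
     n # adjacency_code n (parcs G) @ adjacency_code n C)"

fun answer_code :: "nat list list option \<Rightarrow> nat list" where
  "answer_code None = [0]"
| "answer_code (Some ps) = 1 # length ps # concat (map (\<lambda>p. length p # p) ps)"

end

theory Submission
  imports Defs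
begin

text \<open>
  In a transitive closure of a path with nodes in positions \<open>0, ..., n - 1\<close>, every nonempty set of positions is
  the node set of exactly one path. An optimal cover, if there is one, has at most two paths. Choose
  one arc of \<open>C\<close> on each path of a cover, and let \<open>(c, d)\<close> be the chosen arc that starts last and
  \<open>(a, b)\<close> the one that ends first. Then \<open>b \<noteq> c\<close>, and \<open>b \<le> c + 1\<close>, since otherwise every chosen arc would
  jump over position \<open>c + 1\<close> and no path could visit it. Conversely, for two such arcs of \<open>C\<close>, either one
  of them joins consecutive positions, so that the path through all nodes is feasible, or the
  positions strictly between \<open>a\<close> and \<open>b\<close> together with \<open>c\<close> and \<open>d\<close> form a feasible path, and so do the
  remaining ones. The program sorts the nodes by indegree and then tries all quadruples \<open>(a, b, c, d)\<close>.
\<close>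

section \<open>Running time of RAM programs\<close>

text \<open>Total correctness from one start state with a time budget. The time is only bounded
  above, so that costs can be rounded up to monomials.\<close>

definition runs :: "ram_prog \<Rightarrow> ram_state \<Rightarrow> nat \<Rightarrow> (ram_state \<Rightarrow> bool) \<Rightarrow> bool" where
  "runs c s T Q \<longleftrightarrow> (\<exists>t s'. ram_exec c s t s' \<and> t \<le> T \<and> Q s')"

lemma runs_mono:
  assumes "runs c s T Q" "T \<le> U" "\<And>s'. Q s' \<Longrightarrow> R s'"
  shows "runs c s U R"
  using assms unfolding runs_def by (meson order_trans)

lemma runs_Seq:
  assumes "runs c s T R" and "\<And>s'. R s' \<Longrightarrow> runs d s' U Q"
  shows "runs (Seq c d) s (T + U) Q"
  using assms unfolding runs_def by (meson add_mono ram_exec.Seq)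

text \<open>Determinism turns the existential in \<open>runs\<close> into a statement about the one
  known execution. The instances of this lemma and of \<open>runs_Seq_exact\<close> let the
  simplifier execute straight-line code symbolically.\<close>

lemma runs_exact:
  assumes "ram_exec c s t s'"
  shows "runs c s T Q \<longleftrightarrow> t \<le> T \<and> Q s'"
  unfolding runs_def using assms ram_exec_deterministic[OF assms] by blast

lemma runs_Seq_exact:
  assumes "ram_exec c s t s'"
  shows "runs (Seq c d) s T Q \<longleftrightarrow> t \<le> T \<and> runs d s' (T - t) Q"
proof
  assume "runs (Seq c d) s T Q"
  then obtain u s'' where u: "ram_exec (Seq c d) s u s''" "u \<le> T" "Q s''"
    unfolding runs_def by blast
  from u(1) obtain t1 s1 t2 where "u = t1 + t2" "ram_exec c s t1 s1" "ram_exec d s1 t2 s''"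
    by (rule SeqE)
  moreover from this(2) have "t1 = t" "s1 = s'"
    using ram_exec_deterministic[OF assms] by simp_all
  ultimately show "t \<le> T \<and> runs d s' (T - t) Q"
    using u(2,3) unfolding runs_def by (auto intro!: exI[of _ t2] exI[of _ s''])
next
  assume *: "t \<le> T \<and> runs d s' (T - t) Q"
  then have "runs (Seq c d) s (t + (T - t)) Q"
    by (intro runs_Seq[where R = "\<lambda>x. x = s'"]) (simp_all add: runs_exact[OF assms])
  with * show "runs (Seq c d) s T Q" by simp
qed

lemmas runs_Skip [simp] = runs_exact[OF ram_exec.Skip]
lemmas runs_Assign [simp] = runs_exact[OF ram_exec.Assign]
lemmas runs_Store [simp] = runs_exact[OF ram_exec.Store]
lemmas runs_Assign_Seq [simp] = runs_Seq_exact[OF ram_exec.Assign]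
lemmas runs_Store_Seq [simp] = runs_Seq_exact[OF ram_exec.Store]

lemma runs_If [simp]:
  "runs (If e c d) s T Q \<longleftrightarrow>
     1 \<le> T \<and> (if ram_val e s \<noteq> 0 then runs c s (T - 1) Q else runs d s (T - 1) Q)"
proof
  assume "runs (If e c d) s T Q"
  then obtain t s' where t: "ram_exec (If e c d) s t s'" "t \<le> T" "Q s'"
    unfolding runs_def by blast
  from t(1) show "1 \<le> T \<and> (if ram_val e s \<noteq> 0 then runs c s (T - 1) Q else runs d s (T - 1) Q)"
    by (rule IfE) (use t(2,3) in \<open>auto simp: runs_def intro!: exI[of _ "t - 1"] exI[of _ s']\<close>)
next
  assume *: "1 \<le> T \<and> (if ram_val e s \<noteq> 0 then runs c s (T - 1) Q else runs d s (T - 1) Q)"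
  then obtain t s' where t: "ram_exec (if ram_val e s \<noteq> 0 then c else d) s t s'" "t \<le> T - 1" "Q s'"
    unfolding runs_def by (auto split: if_splits)
  then have "ram_exec (If e c d) s (1 + t) s'"
    using ram_exec.IfFalse[of e s d t s' c] ram_exec.IfTrue[of e s c t s' d]
    by (cases "ram_val e s = 0") simp_all
  moreover have "1 + t \<le> T" using * t(2) by linarith
  ultimately show "runs (If e c d) s T Q" using t(3) unfolding runs_def by blast
qed

section \<open>Counting loops\<close>

definition countdown :: "nat \<Rightarrow> ram_prog \<Rightarrow> ram_prog" where
  "countdown r c = While (Reg r) (Seq (Assign r (Minus (Reg r) (Const 1))) c)"

text \<open>The counter is decremented before the body runs, so the body sees the indices from
  \<open>m - 1\<close> down to 0. Besides the body, a round pays for a test and the decrement; the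
  last 1 is the failing test.\<close>

lemma runs_countdown_exact:
  assumes "reg s r = m" "Inv m s"
    and "\<And>i s. i < m \<Longrightarrow> Inv (Suc i) s \<Longrightarrow> reg s r = Suc i \<Longrightarrow>
      runs c (s\<lparr>reg := (reg s)(r := i)\<rparr>) T (\<lambda>s'. reg s' r = i \<and> Inv i s')"
  shows "runs (countdown r c) s (m * (T + 2) + 1) (\<lambda>s'. reg s' r = 0 \<and> Inv 0 s')"
  using assms
proof (induction m arbitrary: s)
  case 0
  then show ?case
    unfolding runs_def countdown_def by (auto intro!: exI ram_exec.WhileFalse)
next
  case (Suc m)
  let ?s = "s\<lparr>reg := (reg s)(r := m)\<rparr>"
  from Suc.prems obtain t s' where 1: "ram_exec c ?s t s'" "t \<le> T" "reg s' r = m" "Inv m s'"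
    unfolding runs_def by blast
  from Suc.IH[OF 1(3,4)] Suc.prems(3) obtain u s'' where
    2: "ram_exec (countdown r c) s' u s''" "u \<le> m * (T + 2) + 1" "reg s'' r = 0" "Inv 0 s''"
    unfolding runs_def by (metis less_Suc_eq)
  have "ram_exec (Assign r (Minus (Reg r) (Const 1))) s 1 ?s"
    using ram_exec.Assign[of r "Minus (Reg r) (Const 1)" s] Suc.prems(1) by simp
  from ram_exec.Seq[OF this 1(1)]
  have "ram_exec (Seq (Assign r (Minus (Reg r) (Const 1))) c) s (1 + t) s'" .
  from ram_exec.WhileTrue[of "Reg r", OF _ this 2(1)[unfolded countdown_def]]
  have "ram_exec (countdown r c) s (1 + (1 + t) + u) s''"
    unfolding countdown_def using Suc.prems(1) by simp
  with 1 2 show ?case unfolding runs_def by (intro exI[of _ "1 + (1 + t) + u"] exI[of _ s'']) auto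
qed

text \<open>Rounds the cost to one monomial, so that each nested loop just raises the exponent by
  one: the overhead of at most \<open>2 * N + 1\<close> is absorbed by
  \<open>3 * N ^ Suc j\<close>.\<close>

lemma runs_countdown:
  assumes "reg s r = m" "Inv m s" "m \<le> N" "1 \<le> N"
    and body: "\<And>i s. i < m \<Longrightarrow> Inv (Suc i) s \<Longrightarrow> reg s r = Suc i \<Longrightarrow>
      runs c (s\<lparr>reg := (reg s)(r := i)\<rparr>) (k * N ^ j) (\<lambda>s'. reg s' r = i \<and> Inv i s')"
    and post: "\<And>s'. reg s' r = 0 \<Longrightarrow> Inv 0 s' \<Longrightarrow> Q s'"
  shows "runs (countdown r c) s ((k + 3) * N ^ Suc j) Q"
proof (rule runs_mono[OF runs_countdown_exact[where Inv = Inv and r = r and m = m and c = c, OF assms(1,2) body]])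
  have "m * (k * N ^ j + 2) \<le> N * (k * N ^ j + 2)"
    using assms(3) by (rule mult_right_mono) simp
  moreover have "N \<le> N ^ Suc j" "1 \<le> N ^ Suc j"
    using assms(4) by simp_all
  moreover have "N * (k * N ^ j + 2) = k * N ^ Suc j + 2 * N"
    "(k + 3) * N ^ Suc j = k * N ^ Suc j + 3 * N ^ Suc j"
    by (simp_all add: algebra_simps)
  ultimately show "m * (k * N ^ j + 2) + 1 \<le> (k + 3) * N ^ Suc j"
    by linarith
qed (use post in auto)

definition for_each :: "nat \<Rightarrow> ram_prog \<Rightarrow> ram_prog" where
  "for_each r c = Seq (Assign r (Reg 1)) (countdown r c)"

lemma runs_for_each:
  assumes "Inv (reg s 1) (s\<lparr>reg := (reg s)(r := reg s 1)\<rparr>)" "reg s 1 \<le> N" "1 \<le> N"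
    and "\<And>i s'. i < reg s 1 \<Longrightarrow> Inv (Suc i) s' \<Longrightarrow> reg s' r = Suc i \<Longrightarrow>
      runs c (s'\<lparr>reg := (reg s')(r := i)\<rparr>) (k * N ^ j) (\<lambda>s''. reg s'' r = i \<and> Inv i s'')"
    and "\<And>s'. reg s' r = 0 \<Longrightarrow> Inv 0 s' \<Longrightarrow> Q s'"
  shows "runs (for_each r c) s ((k + 4) * N ^ Suc j) Q"
proof -
  have "runs (countdown r c) (s\<lparr>reg := (reg s)(r := reg s 1)\<rparr>) ((k + 3) * N ^ Suc j) Q"
    by (rule runs_countdown[where Inv = Inv and m = "reg s 1"]) (use assms in auto)
  then have "runs (for_each r c) s (1 + (k + 3) * N ^ Suc j) Q"
    unfolding for_each_def by simp
  moreover have "1 \<le> N ^ Suc j" using assms(3) by simp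
  then have "1 + (k + 3) * N ^ Suc j \<le> (k + 4) * N ^ Suc j" by (simp add: algebra_simps)
  ultimately show ?thesis by (rule runs_mono)
qed

definition Neg :: "ram_expr \<Rightarrow> ram_expr" where
  "Neg e = Minus (Const 1) e"

text \<open>By truncated subtraction this is the minimum of the two values.\<close>

definition Conj :: "ram_expr \<Rightarrow> ram_expr \<Rightarrow> ram_expr" where
  "Conj e f = Minus e (Minus e f)"

definition Differ :: "ram_expr \<Rightarrow> ram_expr \<Rightarrow> ram_expr" where
  "Differ e f = Plus (Minus e f) (Minus f e)"

lemma ram_val_Neg [simp]: "ram_val (Neg e) s = 0 \<longleftrightarrow> ram_val e s \<noteq> 0"
  by (auto simp: Neg_def)

lemma ram_val_Conj [simp]: "ram_val (Conj e f) s = 0 \<longleftrightarrow> ram_val e s = 0 \<or> ram_val f s = 0"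
  by (auto simp: Conj_def)

lemma ram_val_Differ [simp]: "ram_val (Differ e f) s = 0 \<longleftrightarrow> ram_val e s = ram_val f s"
  by (auto simp: Differ_def)


section \<open>Covers of transitive closures of paths\<close>

lemma vwalk_arcs_map: "vwalk_arcs (map f ks) = map (map_prod f f) (vwalk_arcs ks)"
  by (induction ks rule: vwalk_arcs.induct) auto

lemma vwalk_arcs_subset: "(i, j) \<in> set (vwalk_arcs ks) \<Longrightarrow> i \<in> set ks \<and> j \<in> set ks"
  by (induction ks rule: vwalk_arcs.induct) auto

lemma sorted_wrt_vwalk_arcs:
  "transp R \<Longrightarrow> sorted_wrt R ks \<longleftrightarrow> (\<forall>(i, j) \<in> set (vwalk_arcs ks). R i j)"
  by (induction ks rule: vwalk_arcs.induct) (auto dest: transpD)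

text \<open>An arc joins neighbours of the sorted list, so it jumps over no member. This yields the
  obstruction to covering a node that all chosen arcs jump over.\<close>

lemma vwalk_arcs_gap:
  fixes ks :: "'a::linorder list"
  assumes "sorted_wrt (<) ks" "(i, j) \<in> set (vwalk_arcs ks)" "x \<in> set ks"
  shows "x \<le> i \<or> j \<le> x"
  using assms
proof (induction ks rule: vwalk_arcs.induct)
  case (3 y z ks)
  then show ?case using vwalk_arcs_subset[of i j "z # ks"] by (force dest: less_imp_le)
qed auto

lemma vwalk_arcs_filter_upt:
  assumes "a < b" "b < n" "I a" "I b" and gap: "\<And>x. a < x \<Longrightarrow> x < b \<Longrightarrow> \<not> I x"
  shows "(a, b) \<in> set (vwalk_arcs (filter I [0..<n]))"
proof -
  \<comment> \<open>Cutting the range at \<open>a\<close> and \<open>b\<close> isolates the block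
    between them, which the filter deletes entirely.\<close>
  have "[0..<n] = [0..<a] @ [a..<n]" "[a..<n] = a # [Suc a..<b] @ [b..<n]" "[b..<n] = b # [Suc b..<n]"
    using assms upt_add_eq_append[of 0 a "n - a"] upt_add_eq_append[of "Suc a" b "n - b"]
    by (simp_all add: upt_conv_Cons)
  then have "[0..<n] = [0..<a] @ a # [Suc a..<b] @ b # [Suc b..<n]" by simp
  moreover have "filter I [Suc a..<b] = []" using gap by (auto simp: filter_empty_conv)
  ultimately have "filter I [0..<n] = filter I [0..<a] @ a # b # filter I [Suc b..<n]"
    using assms by simp
  moreover have "(a, b) \<in> set (vwalk_arcs (a # b # filter I [Suc b..<n]))" by simp
  ultimately show ?thesis using set_vwalk_arcs_append2 by fastforce
qed

locale closure_instance =
  fixes vs :: "'a list" and C :: "'a rel"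
  assumes dist: "distinct vs" and nonempty: "vs \<noteq> []" and C_arcs: "C \<subseteq> parcs (path_closure vs)"
begin

abbreviation "n \<equiv> length vs"
abbreviation "inst \<equiv> (path_closure vs, C)"

definition marked :: "nat \<Rightarrow> nat \<Rightarrow> bool" where
  "marked i j \<longleftrightarrow> i < n \<and> j < n \<and> (vs ! i, vs ! j) \<in> C"

text \<open>\<open>(a, b)\<close> stands for the chosen arc that ends first, \<open>(c, d)\<close>
  for the one that starts last. They may coincide, and then the arc joins consecutive
  positions.\<close>

definition arc_pair :: "nat \<Rightarrow> nat \<Rightarrow> nat \<Rightarrow> nat \<Rightarrow> bool" where
  "arc_pair a b c d \<longleftrightarrow> marked a b \<and> marked c d \<and> b \<le> Suc c \<and> b \<noteq> c"

text \<open>Positions of the path that uses \<open>(c, d)\<close>; all others are left to the path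
  that uses \<open>(a, b)\<close>.\<close>

definition second :: "nat \<Rightarrow> nat \<Rightarrow> nat \<Rightarrow> nat \<Rightarrow> nat \<Rightarrow> bool" where
  "second a b c d x \<longleftrightarrow> a < x \<and> x < b \<or> x = c \<or> x = d"

abbreviation part :: "(nat \<Rightarrow> bool) \<Rightarrow> 'a list" where
  "part I \<equiv> map ((!) vs) (filter I [0..<n])"

lemma nth_in_parcs:
  "i < n \<Longrightarrow> j < n \<Longrightarrow> (vs ! i, vs ! j) \<in> parcs (path_closure vs) \<longleftrightarrow> i < j"
  using dist by (auto simp: path_closure_def nth_eq_iff_index_eq)

lemma marked_less: "marked i j \<Longrightarrow> i < j \<and> j < n"
  using C_arcs nth_in_parcs unfolding marked_def by auto

text \<open>All arcs lead to later positions and \<open>vs\<close> is distinct, so a path amounts to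
  a strictly increasing list of positions. This replaces reasoning about graphs by reasoning about
  sorted lists.\<close>

lemma vpath_path_closure:
  "vpath p (with_proj (path_closure vs)) \<longleftrightarrow>
    (\<exists>ks. p = map ((!) vs) ks \<and> ks \<noteq> [] \<and> set ks \<subseteq> {..<n} \<and> sorted_wrt (<) ks)"
    (is "?L \<longleftrightarrow> (\<exists>ks. ?R ks)")
proof
  assume ?L
  then have p: "set p \<subseteq> set vs" "set (vwalk_arcs p) \<subseteq> parcs (path_closure vs)" "p \<noteq> []"
    by (auto simp: vpath_def vwalk_def path_closure_def)
  from p(1) have "\<forall>x\<in>set p. \<exists>k<n. x = vs ! k" by (metis in_set_conv_nth subsetD)
  then obtain f where f: "\<forall>x\<in>set p. f x < n \<and> x = vs ! f x" by metis
  define ks where "ks = map f p"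
  have ks: "p = map ((!) vs) ks" "set ks \<subseteq> {..<n}" "ks \<noteq> []"
    using f p(3) by (auto simp: ks_def map_idI)
  have "i < j" if "(i, j) \<in> set (vwalk_arcs ks)" for i j
  proof -
    from that ks have "i < n" "j < n" by (auto dest: vwalk_arcs_subset)
    moreover have "(vs ! i, vs ! j) \<in> set (vwalk_arcs p)"
      using that unfolding ks(1) vwalk_arcs_map by force
    ultimately show ?thesis using p(2) nth_in_parcs by blast
  qed
  then have "sorted_wrt (<) ks" by (auto simp: sorted_wrt_vwalk_arcs)
  with ks show "\<exists>ks. ?R ks" by blast
next
  assume "\<exists>ks. ?R ks"
  then obtain ks where ks: "?R ks" by blast
  then have "i < j \<and> i < n \<and> j < n" if "(i, j) \<in> set (vwalk_arcs ks)" for i j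
    using that by (auto simp: sorted_wrt_vwalk_arcs dest: vwalk_arcs_subset)
  then have "set (vwalk_arcs p) \<subseteq> parcs (path_closure vs)"
    using ks by (auto simp: vwalk_arcs_map nth_in_parcs)
  moreover have "distinct p"
    using ks dist by (auto simp: distinct_map inj_on_def nth_eq_iff_index_eq subset_iff
      strict_sorted_iff)
  ultimately show ?L using ks by (auto simp: vpath_def vwalk_def path_closure_def)
qed

lemma feasible_path_iff:
  "feasible_path inst p \<longleftrightarrow>
    (\<exists>ks i j. p = map ((!) vs) ks \<and> set ks \<subseteq> {..<n} \<and> sorted_wrt (<) ks \<and>
      (i, j) \<in> set (vwalk_arcs ks) \<and> marked i j)" (is "?L \<longleftrightarrow> (\<exists>ks i j. ?R ks i j)")
proof
  assume ?L
  then obtain ks where ks: "p = map ((!) vs) ks" "set ks \<subseteq> {..<n}" "sorted_wrt (<) ks"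
    and "set (vwalk_arcs p) \<inter> C \<noteq> {}"
    by (auto simp: feasible_path_def vpath_path_closure)
  then obtain i j where ij: "(i, j) \<in> set (vwalk_arcs ks)" "(vs ! i, vs ! j) \<in> C"
    by (auto simp: vwalk_arcs_map)
  with ks have "marked i j" by (auto simp: marked_def dest: vwalk_arcs_subset)
  with ks ij show "\<exists>ks i j. ?R ks i j" by blast
next
  assume "\<exists>ks i j. ?R ks i j"
  then obtain ks i j where R: "?R ks i j" by blast
  then have "(vs ! i, vs ! j) \<in> set (vwalk_arcs p)" by (force simp: vwalk_arcs_map)
  moreover have "ks \<noteq> []" using R by auto
  ultimately show ?L using R by (auto simp: feasible_path_def vpath_path_closure marked_def)
qed

lemma feasible_part:
  assumes "marked a b" "I a" "I b" "\<And>x. a < x \<Longrightarrow> x < b \<Longrightarrow> \<not> I x"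
  shows "feasible_path inst (part I)"
  unfolding feasible_path_iff
proof (intro exI conjI)
  show "(a, b) \<in> set (vwalk_arcs (filter I [0..<n]))"
    using assms marked_less by (intro vwalk_arcs_filter_upt) auto
qed (use assms in \<open>auto simp: sorted_wrt_filter\<close>)

section \<open>Necessary condition and optimal covers\<close>

lemma cover_nonempty: "feasible_path_cover inst P \<Longrightarrow> P \<noteq> {}"
  using nonempty by (auto simp: feasible_path_cover_def path_closure_def)

text \<open>An extremal choice among one marked arc per path. If there is only one path, both
  extremal arcs are the same, and the bound on their distance forces it to join consecutive
  positions.\<close>

lemma cover_arc_pair:
  assumes "feasible_path_cover inst P"
  shows "\<exists>a b c d. arc_pair a b c d \<and> (card P = 1 \<longrightarrow> b = Suc a)"
proof -
  from assms have fin: "finite P" and feas: "\<And>p. p \<in> P \<Longrightarrow> feasible_path inst p"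
    and disj: "pairwise (\<lambda>p q. disjnt (set p) (set q)) P" and cov: "(\<Union>p\<in>P. set p) = set vs"
    by (auto simp: feasible_path_cover_def path_closure_def)
  define R where "R p ks i j \<longleftrightarrow> p = map ((!) vs) ks \<and> set ks \<subseteq> {..<n} \<and> sorted_wrt (<) ks \<and>
      (i, j) \<in> set (vwalk_arcs ks) \<and> marked i j" for p ks i j
  have "\<forall>p\<in>P. \<exists>ks i j. R p ks i j" using feas unfolding feasible_path_iff R_def by blast
  \<comment> \<open>\<open>K\<close> gives the positions of a path, \<open>S\<close> and
    \<open>E\<close> the start and end of a marked arc on it.\<close>
  then obtain K S E where KSE: "\<And>p. p \<in> P \<Longrightarrow> R p (K p) (S p) (E p)" by metis
  have P: "P \<noteq> {}" using cover_nonempty assms .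
  \<comment> \<open>\<open>p\<close> carries the arc that starts last and \<open>q\<close> the one
    that ends first; they supply \<open>(c, d)\<close> and \<open>(a, b)\<close>.\<close>
  obtain p where "p \<in> P" "Max (S ` P) = S p" by (rule obtains_MAX[OF fin P])
  then have p: "p \<in> P" "\<And>r. r \<in> P \<Longrightarrow> S r \<le> S p"
    using fin by (auto dest: sym)
  obtain q where "q \<in> P" "Min (E ` P) = E q" by (rule obtains_MIN[OF fin P])
  then have q: "q \<in> P" "\<And>r. r \<in> P \<Longrightarrow> E q \<le> E r"
    using fin by (auto dest: sym)
  have less: "S r < E r" "E r < n" if "r \<in> P" for r
    using KSE[OF that] marked_less by (auto simp: R_def)
  have ends: "vs ! S r \<in> set r" "vs ! E r \<in> set r" if "r \<in> P" for r
  proof -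
    have "set r = (!) vs ` set (K r)" using KSE[OF that] by (metis R_def set_map)
    moreover have "S r \<in> set (K r)" "E r \<in> set (K r)"
      using KSE[OF that] vwalk_arcs_subset[of "S r" "E r" "K r"] by (simp_all add: R_def)
    ultimately show "vs ! S r \<in> set r" "vs ! E r \<in> set r" by auto
  qed
  \<comment> \<open>An arc has distinct ends, and two different paths share no node.\<close>
  have "E q \<noteq> S p"
  proof (cases "p = q")
    case True
    then show ?thesis using less p by fastforce
  next
    case False
    then have "disjnt (set p) (set q)" using disj p q by (auto simp: pairwise_def)
    then show ?thesis using ends p(1) q(1) by (metis disjnt_iff)
  qed
  moreover have "E q \<le> Suc (S p)"
  proof (rule ccontr)
    let ?x = "Suc (S p)"
    assume "\<not> E q \<le> ?x"
    then have x: "?x < E q" "?x < n" using less(2)[OF q(1)] by auto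
    then obtain r where r: "r \<in> P" "vs ! ?x \<in> set r" using cov by (metis UN_iff nth_mem)
    moreover have "set r = (!) vs ` set (K r)" "set (K r) \<subseteq> {..<n}"
      using KSE[OF r(1)] unfolding R_def by (metis set_map, blast)
    ultimately obtain k where "k \<in> set (K r)" "k < n" "vs ! k = vs ! ?x" by auto
    then have "?x \<in> set (K r)" using dist x by (simp add: nth_eq_iff_index_eq)
    \<comment> \<open>The path through \<open>?x\<close> cannot jump over it, yet
      \<open>S r \<le> S p < ?x < E q \<le> E r\<close>.\<close>
    then have "?x \<le> S r \<or> E r \<le> ?x"
      using KSE[OF r(1)] vwalk_arcs_gap by (metis R_def)
    then show False using p(2)[OF r(1)] q(2)[OF r(1)] x by linarith
  qed
  moreover have "E q = Suc (S q)" if "card P = 1"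
  proof -
    have "p = q" using that p(1) q(1) by (metis card_1_singletonE singletonD)
    with \<open>E q \<le> Suc (S p)\<close> less(1)[OF q(1)] show ?thesis by simp
  qed
  moreover have "marked (S q) (E q)" "marked (S p) (E p)"
    using KSE p q by (auto simp: R_def)
  ultimately show ?thesis unfolding arc_pair_def by blast
qed

lemma solution_None:
  assumes "\<nexists>a b c d. arc_pair a b c d"
  shows "mpc_arc_solution inst None"
  using assms cover_arc_pair by auto

text \<open>The path through all nodes uses the arc \<open>(a, Suc a)\<close>; since there is a
  node, every cover has at least one path.\<close>

lemma solution_one:
  assumes "marked a (Suc a)"
  shows "mpc_arc_solution inst (Some [part (\<lambda>_. True)])"
proof -
  have "feasible_path inst (part (\<lambda>_. True))" using assms by (rule feasible_part) auto
  then have "feasible_path_cover inst {part (\<lambda>_. True)}"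
    by (auto simp: feasible_path_cover_def path_closure_def map_nth)
  moreover have "1 \<le> card P" if "feasible_path_cover inst P" for P
    using that cover_nonempty[OF that]
    by (simp add: feasible_path_cover_def Suc_le_eq card_gt_0_iff)
  ultimately show ?thesis by (auto simp: is_arg_min_linorder)
qed

text \<open>Without a marked arc between consecutive positions, \<open>cover_arc_pair\<close>
  excludes covers by one path, so two paths are optimal once both parts are feasible.\<close>

lemma solution_two:
  assumes comp: "arc_pair a b c d" and no_single: "\<And>i. \<not> marked i (Suc i)"
  defines "I \<equiv> second a b c d"
  shows "mpc_arc_solution inst (Some [part (\<lambda>x. \<not> I x), part I])" (is "_ (Some [?p, ?q])")
proof -
  have ab: "marked a b" "a < b" "b < n" and cd: "marked c d" "c < d" "d < n"
    and bc: "b \<le> Suc c" "b \<noteq> c"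
    using comp marked_less by (auto simp: arc_pair_def)
  \<comment> \<open>Equality would make an arc consecutive: \<open>a = c\<close> gives
    \<open>b = Suc a\<close>, and \<open>b = d\<close> gives \<open>d = Suc c\<close>.\<close>
  have "a \<noteq> c" "b \<noteq> d"
    using ab cd bc no_single
    by (metis Suc_leI le_antisym, metis Suc_leI le_antisym)
  \<comment> \<open>Neither \<open>a\<close> nor \<open>b\<close> is moved to the second path; for
    instance \<open>a = d\<close> would give \<open>c < a < b \<le> Suc c\<close>.\<close>
  have p: "feasible_path inst ?p"
    using ab(1) by (rule feasible_part) (use ab cd bc \<open>a \<noteq> c\<close> \<open>b \<noteq> d\<close> in \<open>auto simp: I_def second_def\<close>)
  \<comment> \<open>Positions strictly between \<open>a\<close> and \<open>b\<close> are at most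
    \<open>c\<close>, so none separates \<open>c\<close> from \<open>d\<close>.\<close>
  have q: "feasible_path inst ?q"
    using cd(1) by (rule feasible_part) (use ab cd bc in \<open>auto simp: I_def second_def\<close>)
  have "disjnt (set ?p) (set ?q)"
    using dist by (auto simp: disjnt_iff nth_eq_iff_index_eq)
  moreover have "set ?p \<union> set ?q = set vs" unfolding set_conv_nth[of vs] by auto
  ultimately have cover: "feasible_path_cover inst {?p, ?q}"
    using p q by (auto simp: feasible_path_cover_def path_closure_def pairwise_insert disjnt_sym)
  have "?q \<noteq> []" using q by (auto simp: feasible_path_def vpath_def vwalk_def)
  then have "?p \<noteq> ?q" using \<open>disjnt (set ?p) (set ?q)\<close> by (metis disjnt_self_iff_empty set_empty)
  moreover have "2 \<le> card P" if P: "feasible_path_cover inst P" for P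
  proof -
    have "card P \<noteq> 0" using P cover_nonempty[OF P] by (simp add: feasible_path_cover_def)
    moreover have "card P \<noteq> 1" using cover_arc_pair[OF P] no_single by (auto simp: arc_pair_def)
    ultimately show ?thesis by linarith
  qed
  ultimately show ?thesis using cover by (auto simp: is_arg_min_linorder numeral_2_eq_2)
qed

end


section \<open>The program\<close>

text \<open>
  Register 1 holds \<open>n\<close>. Registers 2 and 3 hold the addresses of two tables indexed by positions: the
  node at a position, and the address of the row of that node in the adjacency matrix of \<open>C\<close>.
  Register 11 holds the number of paths of an optimal cover (0 if there is none), and registers 12 to
  15 the positions \<open>a\<close>, \<open>b\<close>, \<open>c\<close>, \<open>d\<close> that determine the second path; the values
  \<open>0, 0, n, n\<close> stand for no second path. Registers 4 to 7 are loop counters.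
\<close>

definition lookup :: "ram_expr \<Rightarrow> ram_expr \<Rightarrow> ram_expr" where
  "lookup e f = Load (Plus (Load (Plus (Reg 3) e)) (Load (Plus (Reg 2) f)))"

text \<open>An indegree, computed as a column sum of the first matrix: register 8 is the address of
  the current entry and advances by the row length \<open>n\<close>.\<close>

definition count_preds :: ram_prog where
  "count_preds =
     for_each 5 (Seq (Assign 10 (Plus (Reg 10) (Load (Reg 8)))) (Assign 8 (Plus (Reg 8) (Reg 1))))"

text \<open>The indegree of a node is its position, so counting predecessors sorts without
  comparisons. The tables lie beyond the input and beyond all output, which is later written from
  address 0 on. Register 9 moves back by \<open>n\<close> from the end of the input and so holds the
  row addresses in the matrix of \<open>C\<close>.\<close>

definition prepare :: ram_prog where
  "prepare =
     Seq (Seq (Assign 1 (Load (Const 0)))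
         (Seq (Assign 2 (Plus (Plus (Reg 0) (Reg 1)) (Plus (Reg 1) (Const 5))))
         (Seq (Assign 3 (Plus (Reg 2) (Reg 1)))
              (Assign 9 (Reg 0)))))
       (for_each 4
         (Seq (Seq (Assign 9 (Minus (Reg 9) (Reg 1)))
              (Seq (Assign 8 (Plus (Reg 4) (Const 1)))
                   (Assign 10 (Const 0))))
         (Seq count_preds
              (Seq (Store (Plus (Reg 2) (Reg 10)) (Reg 4))
                   (Store (Plus (Reg 3) (Reg 10)) (Reg 9))))))"

text \<open>The first conjunct requires that the next position exists; beyond the last one,
  \<open>lookup\<close> reads a meaningless cell.\<close>

definition find_single :: ram_prog where
  "find_single =
     Seq (Assign 11 (Const 0))
       (for_each 4
         (If (Conj (Minus (Reg 1) (Plus (Reg 4) (Const 1))) (lookup (Reg 4) (Plus (Reg 4) (Const 1))))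
           (Assign 11 (Const 1)) Skip))"

definition pair_test :: ram_expr where
  "pair_test =
     Conj (Conj (lookup (Reg 4) (Reg 5)) (lookup (Reg 6) (Reg 7)))
       (Conj (Neg (Minus (Reg 5) (Plus (Reg 6) (Const 1)))) (Differ (Reg 5) (Reg 6)))"

text \<open>There is no early exit: a later hit overwrites an earlier one, and any hit will
  do.\<close>

definition find_pair :: ram_prog where
  "find_pair =
     for_each 4 (for_each 5 (for_each 6 (for_each 7
       (If pair_test
         (Seq (Assign 11 (Const 2)) (Seq (Assign 12 (Reg 4)) (Seq (Assign 13 (Reg 5))
           (Seq (Assign 14 (Reg 6)) (Assign 15 (Reg 7))))))
         Skip))))"

definition search :: ram_prog where
  "search =
     Seq find_single
       (If (Reg 11)
         (Seq (Assign 12 (Const 0)) (Seq (Assign 13 (Const 0))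
           (Seq (Assign 14 (Reg 1)) (Assign 15 (Reg 1)))))
         find_pair)"

text \<open>The length of a path precedes its nodes but is known only after them, so register 9
  keeps the address of that cell until the end. As the loop counter falls, register 10 recovers the
  rising position.\<close>

definition emit :: "ram_expr \<Rightarrow> ram_prog" where
  "emit e =
     Seq (Seq (Assign 9 (Reg 8)) (Assign 8 (Plus (Reg 8) (Const 1))))
    (Seq (for_each 4
           (Seq (Assign 10 (Minus (Minus (Reg 1) (Const 1)) (Reg 4)))
             (If e
               (Seq (Store (Reg 8) (Load (Plus (Reg 2) (Reg 10)))) (Assign 8 (Plus (Reg 8) (Const 1))))
               Skip)))
         (Store (Reg 9) (Minus (Minus (Reg 8) (Reg 9)) (Const 1))))"

definition second_test :: ram_expr where
  "second_test =
     Plus (Conj (Minus (Reg 10) (Reg 12)) (Minus (Reg 13) (Reg 10)))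
       (Plus (Neg (Differ (Reg 10) (Reg 14))) (Neg (Differ (Reg 10) (Reg 15))))"

definition finish :: ram_prog where
  "finish =
     If (Reg 11)
       (Seq (Seq (Store (Const 0) (Const 1)) (Seq (Store (Const 1) (Reg 11)) (Assign 8 (Const 2))))
       (Seq (emit (Neg second_test))
       (Seq (If (Minus (Reg 11) (Const 1)) (emit second_test) Skip)
            (Assign 0 (Reg 8)))))
       (Seq (Store (Const 0) (Const 0)) (Assign 0 (Const 1)))"

definition mpc_program :: ram_prog where
  "mpc_program = Seq prepare (Seq search finish)"

section \<open>Layout of the encoding\<close>

lemma length_adjacency_code [simp]: "length (adjacency_code n R) = n * n"
  by (simp add: adjacency_code_def length_concat sum_list_triv o_def)

text \<open>By induction on the number \<open>m\<close> of rows written: appending a row leaves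
  earlier entries in place, and only for \<open>u = m\<close> does the entry lie in the new
  row.\<close>

lemma adjacency_code_nth:
  assumes "u < n" "v < n"
  shows "adjacency_code n R ! (u * n + v) = of_bool ((u, v) \<in> R)"
proof -
  let ?row = "\<lambda>u. map (\<lambda>v. if (u, v) \<in> R then 1 else 0 :: nat) [0..<n]"
  have "concat (map ?row [0..<m]) ! (u * n + v) = of_bool ((u, v) \<in> R)" if "u < m" for m
    using that
  proof (induction m)
    case (Suc m)
    have len: "length (concat (map ?row [0..<m])) = m * n"
      by (simp add: length_concat sum_list_triv o_def)
    show ?case
    proof (cases "u < m")
      case True
      then have "Suc u * n \<le> m * n" by (intro mult_right_mono) auto
      then have "u * n + v < m * n" using assms(2) by simp
      with True Suc.IH len show ?thesis by (simp add: nth_append)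
    next
      case False
      then have "u = m" using Suc.prems by simp
      with assms(2) len show ?thesis by (simp add: nth_append)
    qed
  qed simp
  then show ?thesis using assms(1) by (simp add: adjacency_code_def)
qed

lemma card_less_Suc_Collect:
  "card {u. u < Suc m \<and> P u} = card {u. u < m \<and> P u} + of_bool (P m)"
proof (cases "P m")
  case True
  then have "{u. u < Suc m \<and> P u} = insert m {u. u < m \<and> P u}" by (auto simp: less_Suc_eq)
  then show ?thesis using True by simp
next
  case False
  then have "{u. u < Suc m \<and> P u} = {u. u < m \<and> P u}" by (auto simp: less_Suc_eq)
  then show ?thesis using False by simp
qed

text \<open>\<open>N\<close> may be any bound on the number of nodes; choosing it from the input
  length turns the time bounds below into bounds in the input length.\<close>

locale standard_instance = closure_instance vs C for vs :: "nat list" and C +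
  fixes N :: nat
  assumes nodes: "set vs = {..<length vs}" and N: "length vs \<le> N"
begin

abbreviation "A \<equiv> parcs (path_closure vs)"
abbreviation "code \<equiv> mpc_arc_code inst"
abbreviation "base \<equiv> length code + n + n + 5"

lemma one_le_N: "1 \<le> N"
  using nonempty N by (cases vs) auto

lemma code_eq: "code = n # adjacency_code n A @ adjacency_code n C"
  using dist by (simp add: mpc_arc_code_def path_closure_def distinct_card Let_def)

lemma length_code: "length code = Suc (n * n + n * n)"
  by (simp add: code_eq)

lemma row_bound: "u < n \<Longrightarrow> v < n \<Longrightarrow> u * n + v < n * n"
proof -
  assume "u < n" "v < n"
  then have "Suc u * n \<le> n * n" by (intro mult_right_mono) auto
  then show ?thesis using \<open>v < n\<close> by simp
qed

text \<open>The successor skips the leading entry \<open>n\<close>, and the offset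
  \<open>n * n\<close> skips the first matrix.\<close>

lemma code_arcs:
  assumes "u < n" "v < n"
  shows "code ! Suc (u * n + v) = of_bool ((u, v) \<in> A)"
    and "code ! Suc (n * n + (u * n + v)) = of_bool ((u, v) \<in> C)"
  using row_bound[OF assms] adjacency_code_nth[OF assms] by (simp_all add: code_eq nth_append)

text \<open>The predecessors of position \<open>k\<close> are exactly the earlier positions, so the
  indegree can serve as the sorting key.\<close>

lemma card_preds:
  assumes "k < n"
  shows "card {u. u < n \<and> (u, vs ! k) \<in> A} = k"
proof -
  have "{u. u < n \<and> (u, vs ! k) \<in> A} = (!) vs ` {..<k}"
  proof (intro set_eqI iffI)
    fix u assume u: "u \<in> {u. u < n \<and> (u, vs ! k) \<in> A}"
    then have "u \<in> set vs" using nodes by simp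
    then obtain i where "i < n" "u = vs ! i" by (auto simp: in_set_conv_nth)
    with u assms show "u \<in> (!) vs ` {..<k}" by (auto simp: nth_in_parcs)
  next
    fix u assume "u \<in> (!) vs ` {..<k}"
    then obtain i where "i < k" "u = vs ! i" by auto
    with assms nodes show "u \<in> {u. u < n \<and> (u, vs ! k) \<in> A}" 
      using nth_mem[of i vs] by (auto simp: nth_in_parcs simp del: nth_mem)
  qed
  moreover have "inj_on ((!) vs) {..<k}"
    using assms dist by (auto simp: inj_on_def nth_eq_iff_index_eq)
  ultimately show ?thesis by (simp add: card_image)
qed

section \<open>Sorting by indegree\<close>

definition input_kept :: "ram_state \<Rightarrow> bool" where
  "input_kept s \<longleftrightarrow> (\<forall>a<length code. mem s a = code ! a)"

lemma runs_count_preds: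
  assumes "v < n" "reg s 1 = n" "reg s 8 = Suc v" "reg s 10 = 0" "input_kept s"
  shows "runs count_preds s (6 * N) (\<lambda>s'. mem s' = mem s \<and>
    (\<forall>r. r \<notin> {5, 8, 10} \<longrightarrow> reg s' r = reg s r) \<and> reg s' 10 = card {u. u < n \<and> (u, v) \<in> A})"
proof -
  \<comment> \<open>The counter falls while the rows are read upwards: with counter
    \<open>i\<close>, the rows below \<open>n - i\<close> have been added and register 8 points into
    row \<open>n - i\<close>.\<close>
  let ?Inv = "\<lambda>i (s' :: ram_state). mem s' = mem s \<and> (\<forall>r. r \<notin> {5, 8, 10} \<longrightarrow> reg s' r = reg s r) \<and>
    reg s' 8 = Suc ((n - i) * n + v) \<and> reg s' 10 = card {u. u < n - i \<and> (u, v) \<in> A}"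
  have "runs count_preds s ((2 + 4) * N ^ Suc 0) (\<lambda>s'. mem s' = mem s \<and>
    (\<forall>r. r \<notin> {5, 8, 10} \<longrightarrow> reg s' r = reg s r) \<and> reg s' 10 = card {u. u < n \<and> (u, v) \<in> A})"
    unfolding count_preds_def
  proof (rule runs_for_each[where Inv = ?Inv])
    fix i and s' :: ram_state
    assume i: "i < reg s 1" and inv: "?Inv (Suc i) s'" and "reg s' 5 = Suc i"
    define m where "m = n - Suc i"
    have m: "n - i = Suc m" "m < n" using i assms(2) by (auto simp: m_def)
    have "mem s (Suc (m * n + v)) = of_bool ((m, v) \<in> A)"
      using code_arcs(1)[OF m(2) assms(1)] row_bound[OF m(2) assms(1)] assms(5)
      by (simp add: input_kept_def length_code)
    moreover have "reg s' 1 = n" using inv assms(2) by simp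
    ultimately show "runs (Seq (Assign 10 (Plus (Reg 10) (Load (Reg 8)))) (Assign 8 (Plus (Reg 8) (Reg 1))))
        (s'\<lparr>reg := (reg s')(5 := i)\<rparr>) (2 * N ^ 0) (\<lambda>s''. reg s'' 5 = i \<and> ?Inv i s'')"
      using inv m by (simp add: m_def[symmetric] card_less_Suc_Collect)
  qed (use assms N one_le_N in auto)
  then show ?thesis by simp
qed

text \<open>This part survives the writing of the answer, unlike \<open>tables\<close>, whose
  entries for \<open>C\<close> sit in input cells that the answer may overwrite.\<close>

definition ordered :: "ram_state \<Rightarrow> bool" where
  "ordered s \<longleftrightarrow> reg s 1 = n \<and> reg s 2 = base \<and> (\<forall>k<n. mem s (base + k) = vs ! k)"

definition tables :: "ram_state \<Rightarrow> bool" where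
  "tables s \<longleftrightarrow> ordered s \<and> reg s 3 = base + n \<and>
     (\<forall>i<n. \<forall>j<n. mem s (mem s (base + n + i) + vs ! j) = of_bool (marked i j))"

text \<open>Nodes are placed in decreasing order of their numbers, so the tables are right for all
  nodes from \<open>i\<close> on.\<close>

definition prepare_inv :: "nat \<Rightarrow> ram_state \<Rightarrow> bool" where
  "prepare_inv i s \<longleftrightarrow> reg s 1 = n \<and> reg s 2 = base \<and> reg s 3 = base + n \<and>
     reg s 9 = Suc (n * n + i * n) \<and> input_kept s \<and>
     (\<forall>k<n. i \<le> vs ! k \<longrightarrow> mem s (base + k) = vs ! k \<and>
        mem s (base + n + k) = Suc (n * n + vs ! k * n))"

lemma prepare_inv_tables:
  assumes "prepare_inv 0 s"
  shows "tables s"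
proof -
  have vs: "vs ! i < n" if "i < n" for i using nodes nth_mem[OF that] by auto
  have "mem s (mem s (base + n + i) + vs ! j) = of_bool (marked i j)" if "i < n" "j < n" for i j
  proof -
    have "mem s (base + n + i) = Suc (n * n + vs ! i * n)"
      using assms that unfolding prepare_inv_def by blast
    moreover have "Suc (n * n + vs ! i * n) + vs ! j < length code"
      using row_bound[OF vs vs, OF that] by (simp add: length_code)
    ultimately have "mem s (mem s (base + n + i) + vs ! j) = code ! Suc (n * n + (vs ! i * n + vs ! j))"
      using assms by (simp add: prepare_inv_def input_kept_def add.assoc)
    also have "\<dots> = of_bool (marked i j)"
      using code_arcs(2)[OF vs vs, OF that] that by (simp add: marked_def)
    finally show ?thesis .
  qed
  moreover have "ordered s" using assms unfolding prepare_inv_def ordered_def by blast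
  ultimately show ?thesis using assms unfolding tables_def prepare_inv_def by blast
qed

lemma runs_prepare: "runs prepare (ram_input code) (19 * N\<^sup>2) tables"
proof -
  \<comment> \<open>Makes the condition on the tables vacuous at the start, when the counter is
    \<open>n\<close>.\<close>
  have outside: "n \<le> vs ! k \<longleftrightarrow> False" if "k < n" for k
    using nodes nth_mem[OF that] by auto
  have "runs prepare (ram_input code) (4 + (11 + 4) * N ^ Suc 1) tables"
    unfolding prepare_def
  proof (rule runs_Seq)
    show "runs (Seq (Assign 1 (Load (Const 0)))
         (Seq (Assign 2 (Plus (Plus (Reg 0) (Reg 1)) (Plus (Reg 1) (Const 5))))
         (Seq (Assign 3 (Plus (Reg 2) (Reg 1)))
              (Assign 9 (Reg 0))))) (ram_input code) 4 (prepare_inv n)"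
      using outside unfolding prepare_inv_def input_kept_def
      by (auto simp: ram_input_def length_code) (simp_all add: code_eq)
  next
    fix s assume s: "prepare_inv n s"
    show "runs (for_each 4
         (Seq (Seq (Assign 9 (Minus (Reg 9) (Reg 1)))
              (Seq (Assign 8 (Plus (Reg 4) (Const 1)))
                   (Assign 10 (Const 0))))
         (Seq count_preds
              (Seq (Store (Plus (Reg 2) (Reg 10)) (Reg 4))
                   (Store (Plus (Reg 3) (Reg 10)) (Reg 9)))))) s ((11 + 4) * N ^ Suc 1) tables"
    proof (rule runs_for_each[where Inv = prepare_inv])
      fix i s' assume "i < reg s 1" and inv: "prepare_inv (Suc i) s'" and "reg s' 4 = Suc i"
      then have i: "i < n" using s by (simp add: prepare_inv_def)
      then obtain k where k: "k < n" "vs ! k = i" using nodes by (metis in_set_conv_nth lessThan_iff)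
      let ?R = "\<lambda>s'' :: ram_state. reg s'' 1 = n \<and> reg s'' 2 = base \<and> reg s'' 3 = base + n \<and> reg s'' 4 = i \<and>
        reg s'' 9 = Suc (n * n + i * n) \<and> mem s'' = mem s'"
      have "runs (Seq (Seq (Assign 9 (Minus (Reg 9) (Reg 1)))
              (Seq (Assign 8 (Plus (Reg 4) (Const 1)))
                   (Assign 10 (Const 0))))
         (Seq count_preds
              (Seq (Store (Plus (Reg 2) (Reg 10)) (Reg 4))
                   (Store (Plus (Reg 3) (Reg 10)) (Reg 9))))) (s'\<lparr>reg := (reg s')(4 := i)\<rparr>)
         (3 + (6 * N + 2)) (\<lambda>s''. reg s'' 4 = i \<and> prepare_inv i s'')"
      proof (intro runs_Seq)
        show "runs (Seq (Assign 9 (Minus (Reg 9) (Reg 1)))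
              (Seq (Assign 8 (Plus (Reg 4) (Const 1)))
                   (Assign 10 (Const 0)))) (s'\<lparr>reg := (reg s')(4 := i)\<rparr>) 3
           (\<lambda>s''. ?R s'' \<and> reg s'' 8 = Suc i \<and> reg s'' 10 = 0)"
          using inv by (simp add: prepare_inv_def)
      next
        fix s'' assume R: "?R s'' \<and> reg s'' 8 = Suc i \<and> reg s'' 10 = 0"
        then have "input_kept s''" using inv by (simp add: prepare_inv_def input_kept_def)
        then have "runs count_preds s'' (6 * N) (\<lambda>t. mem t = mem s'' \<and>
            (\<forall>r. r \<notin> {5, 8, 10} \<longrightarrow> reg t r = reg s'' r) \<and> reg t 10 = card {u. u < n \<and> (u, i) \<in> A})"
          using R i by (intro runs_count_preds) auto
        \<comment> \<open>By \<open>card_preds\<close>, the count is the position \<open>k\<close>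
          of node \<open>i\<close>.\<close>
        then show "runs count_preds s'' (6 * N) (\<lambda>t. ?R t \<and> reg t 10 = k)"
          by (rule runs_mono) (use R card_preds[OF k(1)] k(2) in auto)
      next
        fix t assume t: "?R t \<and> reg t 10 = k"
        have "prepare_inv i (t\<lparr>mem := (mem t)(base + k := i, base + n + k := Suc (n * n + i * n))\<rparr>)"
          unfolding prepare_inv_def
        proof (intro conjI allI impI)
          show "input_kept (t\<lparr>mem := (mem t)(base + k := i, base + n + k := Suc (n * n + i * n))\<rparr>)"
            using inv t by (auto simp: prepare_inv_def input_kept_def)
          fix l assume l: "l < n" "i \<le> vs ! l"
          \<comment> \<open>A position other than \<open>k\<close> holds a node greater than
            \<open>i\<close>, which was placed in an earlier round.\<close>
          have "mem s' (base + l) = vs ! l" "mem s' (base + n + l) = Suc (n * n + vs ! l * n)" if "l \<noteq> k"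
          proof -
            have "vs ! l \<noteq> i" using that k l dist by (auto simp: nth_eq_iff_index_eq)
            with l inv show "mem s' (base + l) = vs ! l" "mem s' (base + n + l) = Suc (n * n + vs ! l * n)"
              unfolding prepare_inv_def by (simp_all add: Suc_le_eq)
          qed
          then show "mem (t\<lparr>mem := (mem t)(base + k := i, base + n + k := Suc (n * n + i * n))\<rparr>) (base + l) = vs ! l"
            "mem (t\<lparr>mem := (mem t)(base + k := i, base + n + k := Suc (n * n + i * n))\<rparr>) (base + n + l) =
              Suc (n * n + vs ! l * n)"
            using t l k by auto
        qed (use t in simp_all)
        then show "runs (Seq (Store (Plus (Reg 2) (Reg 10)) (Reg 4)) (Store (Plus (Reg 3) (Reg 10)) (Reg 9))) t 2
            (\<lambda>s''. reg s'' 4 = i \<and> prepare_inv i s'')"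
          using t by simp
      qed
      then show "runs (Seq (Seq (Assign 9 (Minus (Reg 9) (Reg 1)))
              (Seq (Assign 8 (Plus (Reg 4) (Const 1)))
                   (Assign 10 (Const 0))))
         (Seq count_preds
              (Seq (Store (Plus (Reg 2) (Reg 10)) (Reg 4))
                   (Store (Plus (Reg 3) (Reg 10)) (Reg 9))))) (s'\<lparr>reg := (reg s')(4 := i)\<rparr>)
         (11 * N ^ 1) (\<lambda>s''. reg s'' 4 = i \<and> prepare_inv i s'')"
        by (rule runs_mono) (use one_le_N in auto)
    next
      show "prepare_inv (reg s 1) (s\<lparr>reg := (reg s)(4 := reg s 1)\<rparr>)"
        using s by (simp add: prepare_inv_def input_kept_def)
    qed (use s N one_le_N prepare_inv_tables in \<open>auto simp: prepare_inv_def\<close>)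
  qed
  then show ?thesis
    by (rule runs_mono) (use one_le_N one_le_power[of N 2] in \<open>auto simp: power2_eq_square\<close>)
qed

section \<open>Exhaustive search\<close>

lemma lookup_eq:
  assumes "tables s" "ram_val e s < n" "ram_val f s < n"
  shows "ram_val (lookup e f) s = of_bool (marked (ram_val e s) (ram_val f s))"
  using assms unfolding tables_def ordered_def lookup_def by simp

lemma tables_cong:
  assumes "tables s" "mem s' = mem s" "\<And>r. r \<in> {1, 2, 3} \<Longrightarrow> reg s' r = reg s r"
  shows "tables s'"
  using assms by (simp add: tables_def ordered_def)

definition single_inv :: "nat \<Rightarrow> ram_state \<Rightarrow> bool" where
  "single_inv i s \<longleftrightarrow> tables s \<and> (if reg s 11 = 0 then \<forall>a\<ge>i. \<not> marked a (Suc a)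
     else reg s 11 = 1 \<and> (\<exists>a. marked a (Suc a)))"

lemma runs_find_single:
  assumes "tables s"
  shows "runs find_single s (7 * N) (single_inv 0)"
proof -
  let ?s = "s\<lparr>reg := (reg s)(11 := 0)\<rparr>"
  have t: "tables ?s" by (rule tables_cong[OF assms]) auto
  have "runs (for_each 4
         (If (Conj (Minus (Reg 1) (Plus (Reg 4) (Const 1))) (lookup (Reg 4) (Plus (Reg 4) (Const 1))))
           (Assign 11 (Const 1)) Skip)) ?s ((2 + 4) * N ^ Suc 0) (single_inv 0)"
  proof (rule runs_for_each[where Inv = single_inv])
    have "tables (?s\<lparr>reg := (reg ?s)(4 := reg ?s 1)\<rparr>)" by (rule tables_cong[OF t]) auto
    moreover have "\<not> marked a (Suc a)" if "a \<ge> reg ?s 1" for a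
      using that t by (auto simp: tables_def ordered_def marked_def)
    ultimately show "single_inv (reg ?s 1) (?s\<lparr>reg := (reg ?s)(4 := reg ?s 1)\<rparr>)"
      by (simp add: single_inv_def)
  next
    fix i s' assume i: "i < reg ?s 1" and inv: "single_inv (Suc i) s'" and "reg s' 4 = Suc i"
    let ?t = "s'\<lparr>reg := (reg s')(4 := i)\<rparr>"
    have t': "tables ?t" by (rule tables_cong[of s']) (use inv in \<open>auto simp: single_inv_def\<close>)
    have t'': "tables (s'\<lparr>reg := (reg s')(4 := i, 11 := 1)\<rparr>)"
      by (rule tables_cong[OF t']) auto
    have all: "(\<forall>a\<ge>i. \<not> marked a (Suc a)) \<longleftrightarrow> \<not> marked i (Suc i) \<and> (\<forall>a\<ge>Suc i. \<not> marked a (Suc a))"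
      by (metis Suc_leI Suc_leD le_neq_implies_less order_refl)
    have n: "reg s' 1 = n" "i < n" using t' i t by (auto simp: tables_def ordered_def)
    have "ram_val (Conj (Minus (Reg 1) (Plus (Reg 4) (Const 1))) (lookup (Reg 4) (Plus (Reg 4) (Const 1)))) ?t = 0
      \<longleftrightarrow> \<not> marked i (Suc i)"
      using n lookup_eq[OF t', of "Reg 4" "Plus (Reg 4) (Const 1)"]
      by (cases "Suc i < n") (auto simp: marked_def)
    then show "runs (If (Conj (Minus (Reg 1) (Plus (Reg 4) (Const 1))) (lookup (Reg 4) (Plus (Reg 4) (Const 1))))
           (Assign 11 (Const 1)) Skip) ?t (2 * N ^ 0) (\<lambda>s''. reg s'' 4 = i \<and> single_inv i s'')"
      using inv t' t'' unfolding single_inv_def all by (auto simp del: ram_val_Conj)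
  qed (use t N one_le_N in \<open>auto simp: tables_def ordered_def\<close>)
  then have "runs (for_each 4
         (If (Conj (Minus (Reg 1) (Plus (Reg 4) (Const 1))) (lookup (Reg 4) (Plus (Reg 4) (Const 1))))
           (Assign 11 (Const 1)) Skip)) ?s (7 * N - 1) (single_inv 0)"
    by (rule runs_mono) (use one_le_N in auto)
  then show ?thesis unfolding find_single_def using one_le_N by simp
qed

text \<open>\<open>W\<close> is the set of quadruples already tried; as a parameter, it lets all
  four loops share one invariant.\<close>

definition pair_inv :: "(nat \<Rightarrow> nat \<Rightarrow> nat \<Rightarrow> nat \<Rightarrow> bool) \<Rightarrow> ram_state \<Rightarrow> bool" where
  "pair_inv W s \<longleftrightarrow> tables s \<and>
     (if reg s 11 = 0 then \<forall>a b c d. W a b c d \<longrightarrow> \<not> arc_pair a b c d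
      else reg s 11 = 2 \<and> arc_pair (reg s 12) (reg s 13) (reg s 14) (reg s 15))"

text \<open>Since \<open>arc_pair\<close> forces all four positions below \<open>n\<close>, the
  inclusion of \<open>W\<close> in \<open>V\<close> is needed only there.\<close>

lemma pair_inv_cong:
  assumes "pair_inv V s" "mem s' = mem s" "\<And>r. r \<in> {1, 2, 3, 11, 12, 13, 14, 15} \<Longrightarrow> reg s' r = reg s r"
    and "\<And>a b c d. W a b c d \<Longrightarrow> a < n \<Longrightarrow> b < n \<Longrightarrow> c < n \<Longrightarrow> d < n \<Longrightarrow> V a b c d"
  shows "pair_inv W s'"
proof -
  have bound: "a < n \<and> b < n \<and> c < n \<and> d < n" if "arc_pair a b c d" for a b c d
    using that by (auto simp: arc_pair_def marked_def)
  have "tables s'"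
    using assms(1) by (intro tables_cong[OF _ assms(2)]) (auto simp: pair_inv_def assms(3))
  moreover have "\<not> arc_pair a b c d" if "reg s 11 = 0" "W a b c d" for a b c d
    using assms(1,4) that bound[of a b c d] unfolding pair_inv_def by auto
  moreover have "reg s' 11 = reg s 11" "reg s' 12 = reg s 12" "reg s' 13 = reg s 13"
    "reg s' 14 = reg s 14" "reg s' 15 = reg s 15" by (simp_all add: assms(3))
  ultimately show ?thesis using assms(1) unfolding pair_inv_def by simp
qed

lemma pair_test_iff:
  assumes "tables s" "reg s 4 < n" "reg s 5 < n" "reg s 6 < n" "reg s 7 < n"
  shows "ram_val pair_test s = 0 \<longleftrightarrow> \<not> arc_pair (reg s 4) (reg s 5) (reg s 6) (reg s 7)"
  using lookup_eq[OF assms(1), of "Reg 4" "Reg 5"] lookup_eq[OF assms(1), of "Reg 6" "Reg 7"] assms(2-)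
  by (auto simp: pair_test_def arc_pair_def)

lemma pair_inv_reg1: "pair_inv W s \<Longrightarrow> reg s 1 = n"
  by (simp add: pair_inv_def tables_def ordered_def)

text \<open>One loop of the nest: \<open>V\<close> has been tried on entry, \<open>W i\<close> after
  the round with counter \<open>i\<close>, and \<open>U\<close> on exit. \<open>K\<close> contains
  the counters of the outer loops, which must be left alone.\<close>

lemma runs_pair_level:
  assumes inv: "pair_inv V s" and r: "r \<in> {4, 5, 6, 7}" "r \<notin> K"
    and start: "\<And>a b c d. W n a b c d \<Longrightarrow> a < n \<Longrightarrow> b < n \<Longrightarrow> c < n \<Longrightarrow> d < n \<Longrightarrow> V a b c d"
    and stop: "\<And>a b c d. U a b c d \<Longrightarrow> W 0 a b c d"
    and body: "\<And>i s'. i < n \<Longrightarrow> pair_inv (W (Suc i)) s' \<Longrightarrow> reg s' r = i \<Longrightarrow> \<forall>q\<in>K. reg s' q = reg s q \<Longrightarrow>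
      runs c s' (k * N ^ j) (\<lambda>s''. pair_inv (W i) s'' \<and> (\<forall>q\<in>insert r K. reg s'' q = reg s' q))"
  shows "runs (for_each r c) s ((k + 4) * N ^ Suc j)
    (\<lambda>s'. pair_inv U s' \<and> (\<forall>q\<in>K. reg s' q = reg s q))"
proof (rule runs_for_each[where Inv = "\<lambda>i s'. pair_inv (W i) s' \<and> (\<forall>q\<in>K. reg s' q = reg s q)"])
  have n: "reg s 1 = n" using pair_inv_reg1[OF inv] .
  show "pair_inv (W (reg s 1)) (s\<lparr>reg := (reg s)(r := reg s 1)\<rparr>) \<and>
      (\<forall>q\<in>K. reg (s\<lparr>reg := (reg s)(r := reg s 1)\<rparr>) q = reg s q)"
  proof
    show "pair_inv (W (reg s 1)) (s\<lparr>reg := (reg s)(r := reg s 1)\<rparr>)"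
      by (rule pair_inv_cong[OF inv]) (use r n start in auto)
  qed (use r in auto)
  show "reg s 1 \<le> N" "1 \<le> N" using n N one_le_N by simp_all
  fix i s' assume i: "i < reg s 1"
    and s': "pair_inv (W (Suc i)) s' \<and> (\<forall>q\<in>K. reg s' q = reg s q)" and "reg s' r = Suc i"
  have "pair_inv (W (Suc i)) (s'\<lparr>reg := (reg s')(r := i)\<rparr>)"
    by (rule pair_inv_cong[of "W (Suc i)" s']) (use s' r in auto)
  then have "runs c (s'\<lparr>reg := (reg s')(r := i)\<rparr>) (k * N ^ j) (\<lambda>s''. pair_inv (W i) s'' \<and>
      (\<forall>q\<in>insert r K. reg s'' q = reg (s'\<lparr>reg := (reg s')(r := i)\<rparr>) q))"
    by (intro body) (use i n s' r in auto)
  then show "runs c (s'\<lparr>reg := (reg s')(r := i)\<rparr>) (k * N ^ j)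
      (\<lambda>s''. reg s'' r = i \<and> pair_inv (W i) s'' \<and> (\<forall>q\<in>K. reg s'' q = reg s q))"
    by (rule runs_mono) (use s' r in auto)
next
  fix s' assume "pair_inv (W 0) s' \<and> (\<forall>q\<in>K. reg s' q = reg s q)"
  moreover from this have "pair_inv U s'"
    by (intro pair_inv_cong[of "W 0" s' s' U]) (use stop in auto)
  ultimately show "pair_inv U s' \<and> (\<forall>q\<in>K. reg s' q = reg s q)" by blast
qed

lemma runs_find_pair:
  assumes "tables s" "reg s 11 = 0"
  shows "runs find_pair s (22 * N ^ 4) (pair_inv (\<lambda>_ _ _ _. True))"
proof -
  \<comment> \<open>All counters fall, so the quadruples tried are a final segment of the
    lexicographic order, described here for each depth of the nest.\<close>
  let ?W1 = "\<lambda>i a b c d. i \<le> a"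
  let ?W2 = "\<lambda>x i a b c d. x < a \<or> a = x \<and> i \<le> b"
  let ?W3 = "\<lambda>x y i a b c d. x < a \<or> a = x \<and> (y < b \<or> b = y \<and> i \<le> c)"
  let ?W4 = "\<lambda>x y z i a b c d. x < a \<or> a = x \<and> (y < b \<or> b = y \<and> (z < c \<or> c = z \<and> i \<le> d))"
  let ?inner = "If pair_test
         (Seq (Assign 11 (Const 2)) (Seq (Assign 12 (Reg 4)) (Seq (Assign 13 (Reg 5))
           (Seq (Assign 14 (Reg 6)) (Assign 15 (Reg 7))))))
         Skip"
  have 4: "runs ?inner s (6 * N ^ 0)
      (\<lambda>s'. pair_inv (?W4 x y z w) s' \<and> (\<forall>q\<in>{7, 6, 5, 4}. reg s' q = reg s q))"
    if inv: "pair_inv (?W4 x y z (Suc w)) s" and xyz: "reg s 4 = x" "reg s 5 = y" "reg s 6 = z" "reg s 7 = w"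
      and b: "x < n" "y < n" "z < n" "w < n" for s x y z w
  proof -
    let ?u = "s\<lparr>reg := (reg s)(11 := 2, 12 := x, 13 := y, 14 := z, 15 := w)\<rparr>"
    have t: "tables s" using inv by (simp add: pair_inv_def)
    have u: "tables ?u" by (rule tables_cong[OF t]) auto
    have test: "ram_val pair_test s = 0 \<longleftrightarrow> \<not> arc_pair x y z w"
      using pair_test_iff[OF t] xyz b by simp
    show ?thesis
    proof (cases "arc_pair x y z w")
      case True
      then have "pair_inv (?W4 x y z w) ?u" using u by (simp add: pair_inv_def)
      then show ?thesis using True test xyz by simp
    next
      case False
      \<comment> \<open>The only quadruple added by this round is
        \<open>(x, y, z, w)\<close>.\<close>
      then have "\<not> arc_pair a b c d" if "?W4 x y z w a b c d" "\<not> ?W4 x y z (Suc w) a b c d" for a b c d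
        using that by (metis Suc_leI le_neq_implies_less)
      then have "\<not> arc_pair a b c d" if "reg s 11 = 0" "?W4 x y z w a b c d" for a b c d
        using inv that unfolding pair_inv_def by (metis (no_types, lifting))
      then have "pair_inv (?W4 x y z w) s" using inv t unfolding pair_inv_def by simp
      then show ?thesis using False test xyz by simp
    qed
  qed
  have 3: "runs (for_each 7 ?inner) s (10 * N ^ 1)
      (\<lambda>s'. pair_inv (?W3 x y z) s' \<and> (\<forall>q\<in>{6, 5, 4}. reg s' q = reg s q))"
    if inv: "pair_inv (?W3 x y (Suc z)) s" and xyz: "reg s 4 = x" "reg s 5 = y" "reg s 6 = z"
      and b: "x < n" "y < n" "z < n" for s x y z
  proof -
    have "runs (for_each 7 ?inner) s ((6 + 4) * N ^ Suc 0)
        (\<lambda>s'. pair_inv (?W3 x y z) s' \<and> (\<forall>q\<in>{6, 5, 4}. reg s' q = reg s q))"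
      by (rule runs_pair_level[OF inv, where W = "?W4 x y z"], simp, simp, force, force, rule 4)
        (use xyz b in simp_all)
    then show ?thesis by simp
  qed
  have 2: "runs (for_each 6 (for_each 7 ?inner)) s (14 * N ^ 2)
      (\<lambda>s'. pair_inv (?W2 x y) s' \<and> (\<forall>q\<in>{5, 4}. reg s' q = reg s q))"
    if inv: "pair_inv (?W2 x (Suc y)) s" and xyz: "reg s 4 = x" "reg s 5 = y"
      and b: "x < n" "y < n" for s x y
  proof -
    have "runs (for_each 6 (for_each 7 ?inner)) s ((10 + 4) * N ^ Suc 1)
        (\<lambda>s'. pair_inv (?W2 x y) s' \<and> (\<forall>q\<in>{5, 4}. reg s' q = reg s q))"
      by (rule runs_pair_level[OF inv, where W = "?W3 x y"], simp, simp, force, force, rule 3)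
        (use xyz b in simp_all)
    then show ?thesis by (simp add: numeral_2_eq_2)
  qed
  have 1: "runs (for_each 5 (for_each 6 (for_each 7 ?inner))) s (18 * N ^ 3)
      (\<lambda>s'. pair_inv (?W1 x) s' \<and> (\<forall>q\<in>{4}. reg s' q = reg s q))"
    if inv: "pair_inv (?W1 (Suc x)) s" and xyz: "reg s 4 = x" and b: "x < n" for s x
  proof -
    have "runs (for_each 5 (for_each 6 (for_each 7 ?inner))) s ((14 + 4) * N ^ Suc 2)
        (\<lambda>s'. pair_inv (?W1 x) s' \<and> (\<forall>q\<in>{4}. reg s' q = reg s q))"
      by (rule runs_pair_level[OF inv, where W = "?W2 x"], simp, simp, force, force, rule 2)
        (use xyz b in simp_all)
    then show ?thesis by (simp add: eval_nat_numeral)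
  qed
  have inv: "pair_inv (\<lambda>_ _ _ _. False) s" using assms by (simp add: pair_inv_def)
  have "runs find_pair s ((18 + 4) * N ^ Suc 3)
      (\<lambda>s'. pair_inv (\<lambda>_ _ _ _. True) s' \<and> (\<forall>q\<in>{}. reg s' q = reg s q))"
    unfolding find_pair_def
    by (rule runs_pair_level[OF inv, where W = ?W1], simp, simp, force, force, rule 1) simp_all
  then show ?thesis by (simp add: eval_nat_numeral)
qed

definition found :: "ram_state \<Rightarrow> bool" where
  "found s \<longleftrightarrow> ordered s \<and>
    (reg s 11 = 0 \<and> (\<nexists>a b c d. arc_pair a b c d) \<or>
     reg s 11 = 1 \<and> (\<exists>a. marked a (Suc a)) \<and>
       reg s 12 = 0 \<and> reg s 13 = 0 \<and> reg s 14 = n \<and> reg s 15 = n \<or>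
     reg s 11 = 2 \<and> (\<nexists>a. marked a (Suc a)) \<and>
       arc_pair (reg s 12) (reg s 13) (reg s 14) (reg s 15))"

text \<open>The quadruples are tried only if no marked arc joins consecutive positions, which is
  what \<open>solution_two\<close> requires.\<close>

lemma runs_search:
  assumes "tables s"
  shows "runs search s (30 * N ^ 4) found"
proof -
  have "runs search s (7 * N + 23 * N ^ 4) found"
    unfolding search_def
  proof (rule runs_Seq[OF runs_find_single[OF assms]])
    fix s' assume inv: "single_inv 0 s'"
    have N4: "1 \<le> N ^ 4" using one_le_N by simp
    show "runs (If (Reg 11)
         (Seq (Assign 12 (Const 0)) (Seq (Assign 13 (Const 0))
           (Seq (Assign 14 (Reg 1)) (Assign 15 (Reg 1)))))
         find_pair) s' (23 * N ^ 4) found"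
    proof (cases "reg s' 11 = 0")
      case True
      then have none: "\<nexists>a. marked a (Suc a)" using inv by (auto simp: single_inv_def)
      have "runs find_pair s' (22 * N ^ 4) (pair_inv (\<lambda>_ _ _ _. True))"
        using inv True by (intro runs_find_pair) (auto simp: single_inv_def)
      then have "runs find_pair s' (23 * N ^ 4 - 1) found"
        by (rule runs_mono)
          (use none N4 in \<open>auto simp: pair_inv_def found_def tables_def split: if_splits\<close>)
      then show ?thesis using True N4 by simp
    next
      case False
      then show ?thesis using inv N4 by (auto simp: single_inv_def found_def tables_def ordered_def)
    qed
  qed
  then show ?thesis
    by (rule runs_mono) (use one_le_N self_le_power[of N 4] in auto)
qed

section \<open>Writing the answer\<close>

definition written :: "nat list \<Rightarrow> ram_state \<Rightarrow> bool" where
  "written ys s \<longleftrightarrow> ordered s \<and> reg s 8 = length ys \<and> (\<forall>k<length ys. mem s k = ys ! k)"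

text \<open>The bound on \<open>length ys + n\<close> keeps all writes below the table of nodes,
  which is still being read. The truth of the test may depend only on the position in register 10
  and on registers from 11 on, which stay fixed.\<close>

lemma runs_emit:
  assumes "written ys s" "length ys + n < base"
    and test: "\<And>s' x. x < n \<Longrightarrow> reg s' 10 = x \<Longrightarrow> (\<forall>r\<ge>11. reg s' r = reg s r) \<Longrightarrow>
      ram_val e s' = 0 \<longleftrightarrow> \<not> I x"
  shows "runs (emit e) s (11 * N)
    (\<lambda>s'. written (ys @ length (part I) # part I) s' \<and> (\<forall>r\<ge>11. reg s' r = reg s r))"
proof -
  \<comment> \<open>\<open>h\<close> is whatever the cell reserved for the length contains before it
    is filled; \<open>out i\<close> is the output with counter \<open>i\<close>, including that
    cell.\<close>
  define h where "h = mem s (length ys)"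
  define out where "out i = ys @ h # map ((!) vs) (filter I [0..<n - i])" for i
  have len: "length (out i) = Suc (length ys + length (filter I [0..<n - i]))"
    "length (filter I [0..<n - i]) \<le> n - i" for i
    using length_filter_le[of I "[0..<n - i]"] by (simp_all add: out_def)
  let ?Inv = "\<lambda>i s'. written (out i) s' \<and> reg s' 9 = length ys \<and> (\<forall>r\<ge>11. reg s' r = reg s r)"
  have "runs (emit e) s (2 + ((4 + 4) * N ^ Suc 0 + 1))
    (\<lambda>s'. written (ys @ length (part I) # part I) s' \<and> (\<forall>r\<ge>11. reg s' r = reg s r))"
    unfolding emit_def
  proof (intro runs_Seq)
    show "runs (Seq (Assign 9 (Reg 8)) (Assign 8 (Plus (Reg 8) (Const 1)))) s 2 (?Inv n)"
      using assms(1) by (auto simp: written_def ordered_def out_def nth_append h_def less_Suc_eq)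
  next
    fix s' assume inv: "?Inv n s'"
    then have n: "reg s' 1 = n" by (simp add: written_def ordered_def)
    show "runs (for_each 4
           (Seq (Assign 10 (Minus (Minus (Reg 1) (Const 1)) (Reg 4)))
             (If e
               (Seq (Store (Reg 8) (Load (Plus (Reg 2) (Reg 10)))) (Assign 8 (Plus (Reg 8) (Const 1))))
               Skip))) s' ((4 + 4) * N ^ Suc 0) (?Inv 0)"
    proof (rule runs_for_each[where Inv = ?Inv])
      fix i t assume i: "i < reg s' 1" and inv: "?Inv (Suc i) t" and "reg t 4 = Suc i"
      define x where "x = n - Suc i"
      have x: "x < n" "n - i = Suc x" "n - 1 - i = x" using i n by (auto simp: x_def)
      let ?t = "t\<lparr>reg := (reg t)(4 := i, 10 := x)\<rparr>"
      have val: "ram_val e ?t = 0 \<longleftrightarrow> \<not> I x" using inv x by (intro test) auto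
      have t: "reg t 1 = n" "reg t 2 = base" "mem t (base + x) = vs ! x"
        "reg t 8 = length (out (Suc i))"
        using inv x by (auto simp: written_def ordered_def)
      have out: "out i = out (Suc i) @ (if I x then [vs ! x] else [])"
        using x by (simp add: out_def x_def[symmetric])
      have small: "length (out (Suc i)) < base"
        using len(2)[of "Suc i"] x assms(2) unfolding len(1) x_def by linarith
      have "?Inv i (if I x then t\<lparr>mem := (mem t)(reg t 8 := vs ! x),
          reg := (reg t)(4 := i, 10 := x, 8 := Suc (reg t 8))\<rparr> else ?t)"
        using inv small by (auto simp: out written_def ordered_def nth_append less_Suc_eq)
      then show "runs (Seq (Assign 10 (Minus (Minus (Reg 1) (Const 1)) (Reg 4)))
             (If e
               (Seq (Store (Reg 8) (Load (Plus (Reg 2) (Reg 10)))) (Assign 8 (Plus (Reg 8) (Const 1))))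
               Skip)) (t\<lparr>reg := (reg t)(4 := i)\<rparr>) (4 * N ^ 0) (\<lambda>s''. reg s'' 4 = i \<and> ?Inv i s'')"
        using x val t by (cases "I x") simp_all
    qed (use inv n N one_le_N in \<open>auto simp: written_def ordered_def\<close>)
  next
    fix s' assume inv: "?Inv 0 s'"
    \<comment> \<open>The distance from the reserved cell to the end of the output, less the cell
      itself, is the length of the path.\<close>
    have "ys @ length (part I) # part I = (out 0)[length ys := reg s' 8 - reg s' 9 - 1]"
      using inv by (simp add: out_def written_def)
    then show "runs (Store (Reg 9) (Minus (Minus (Reg 8) (Reg 9)) (Const 1))) s' 1
      (\<lambda>s'. written (ys @ length (part I) # part I) s' \<and> (\<forall>r\<ge>11. reg s' r = reg s r))"
      using inv assms(2) by (auto simp: written_def ordered_def nth_list_update)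
  qed
  then show ?thesis by (rule runs_mono) (use one_le_N in auto)
qed

lemma ram_output_written:
  assumes "written ys s"
  shows "ram_output (s\<lparr>reg := (reg s)(0 := reg s 8)\<rparr>) = ys"
  using assms by (intro nth_equalityI) (auto simp: ram_output_def written_def)

lemma second_test_eq:
  "ram_val second_test s = 0 \<longleftrightarrow> \<not> second (reg s 12) (reg s 13) (reg s 14) (reg s 15) (reg s 10)"
  by (auto simp: second_test_def second_def)

lemma runs_finish:
  assumes "found s"
  shows "runs finish s (28 * N) (\<lambda>s'. \<exists>y. ram_output s' = answer_code y \<and> mpc_arc_solution inst y)"
    (is "runs _ _ _ ?Q")
proof (cases "reg s 11 = 0")
  case True
  then have "mpc_arc_solution inst None" using assms by (intro solution_None) (auto simp: found_def)
  then show ?thesis using True one_le_N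
    by (auto simp: finish_def ram_output_def intro!: exI[of _ None])
next
  case False
  define I where "I = second (reg s 12) (reg s 13) (reg s 14) (reg s 15)"
  define J where "J x \<longleftrightarrow> \<not> I x" for x
  define sol where "sol = (if reg s 11 = 1 then [part J] else [part J, part I])"
  have sol: "mpc_arc_solution inst (Some sol)"
  proof (cases "reg s 11 = 1")
    case True
    \<comment> \<open>Here the registers hold \<open>0, 0, n, n\<close>, so \<open>I\<close>
      contains no position below \<open>n\<close>.\<close>
    then have "part J = part (\<lambda>_. True)"
      using assms by (auto simp: J_def I_def found_def second_def intro!: filter_cong)
    with True show ?thesis using assms solution_one by (auto simp: sol_def found_def)
  next
    case False
    with \<open>reg s 11 \<noteq> 0\<close> have "arc_pair (reg s 12) (reg s 13) (reg s 14) (reg s 15)"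
      "\<And>a. \<not> marked a (Suc a)" "reg s 11 = 2" using assms by (auto simp: found_def)
    moreover have "J = (\<lambda>x. \<not> I x)" by (auto simp: J_def)
    ultimately show ?thesis using solution_two by (simp add: sol_def I_def)
  qed
  have lens: "length (part K) \<le> n" for K
    using length_filter_le[of K "[0..<n]"] by simp
  let ?keep = "\<lambda>s'. \<forall>r\<ge>11. reg s' r = reg s r"
  define ys where "ys = [1, reg s 11] @ length (part J) # part J"
  have "runs finish s (1 + (3 + (11 * N + ((1 + 11 * N) + 1)))) ?Q"
    unfolding finish_def
  proof -
    have "runs (Seq (Seq (Store (Const 0) (Const 1)) (Seq (Store (Const 1) (Reg 11)) (Assign 8 (Const 2))))
       (Seq (emit (Neg second_test))
       (Seq (If (Minus (Reg 11) (Const 1)) (emit second_test) Skip)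
            (Assign 0 (Reg 8))))) s (3 + (11 * N + ((1 + 11 * N) + 1))) ?Q"
    proof (intro runs_Seq)
      show "runs (Seq (Store (Const 0) (Const 1)) (Seq (Store (Const 1) (Reg 11)) (Assign 8 (Const 2)))) s 3
        (\<lambda>s'. written [1, reg s 11] s' \<and> ?keep s')"
        using assms by (simp add: written_def ordered_def found_def less_Suc_eq nth_Cons')
    next
      fix s' assume s': "written [1, reg s 11] s' \<and> ?keep s'"
      have "runs (emit (Neg second_test)) s' (11 * N)
        (\<lambda>t. written ([1, reg s 11] @ length (part J) # part J) t \<and> (\<forall>r\<ge>11. reg t r = reg s' r))"
        by (rule runs_emit) (use s' in \<open>auto simp: second_test_eq J_def I_def\<close>)
      then show "runs (emit (Neg second_test)) s' (11 * N) (\<lambda>t. written ys t \<and> ?keep t)"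
        by (rule runs_mono) (use s' in \<open>auto simp: ys_def\<close>)
    next
      fix s' assume s': "written ys s' \<and> ?keep s'"
      have *: "written (answer_code (Some sol)) s'" if "reg s 11 = 1"
        using s' that by (simp add: sol_def ys_def)
      have "runs (emit second_test) s' (11 * N)
        (\<lambda>t. written (ys @ length (part I) # part I) t \<and> (\<forall>r\<ge>11. reg t r = reg s' r))"
        by (rule runs_emit) (use s' lens[of J] in \<open>auto simp: second_test_eq ys_def I_def\<close>)
      then have "runs (emit second_test) s' (11 * N) (written (answer_code (Some sol)))" if "reg s 11 \<noteq> 1"
        by (rule runs_mono) (use that False assms in \<open>auto simp: ys_def sol_def found_def numeral_2_eq_2\<close>)
      then show "runs (If (Minus (Reg 11) (Const 1)) (emit second_test) Skip) s' (1 + 11 * N)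
        (written (answer_code (Some sol)))"
        using * s' False one_le_N by auto
    next
      fix s' assume "written (answer_code (Some sol)) s'"
      from ram_output_written[OF this] sol
      show "runs (Assign 0 (Reg 8)) s' 1 ?Q" by (auto intro!: exI[of _ "Some sol"])
    qed
    then show "runs (If (Reg 11)
       (Seq (Seq (Store (Const 0) (Const 1)) (Seq (Store (Const 1) (Reg 11)) (Assign 8 (Const 2))))
       (Seq (emit (Neg second_test))
       (Seq (If (Minus (Reg 11) (Const 1)) (emit second_test) Skip)
            (Assign 0 (Reg 8)))))
       (Seq (Store (Const 0) (Const 0)) (Assign 0 (Const 1)))) s
       (1 + (3 + (11 * N + ((1 + 11 * N) + 1)))) ?Q" using False by simp
  qed
  then show ?thesis by (rule runs_mono) (use one_le_N in auto)
qed

section \<open>Total running time\<close>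

lemma runs_mpc_program:
  "runs mpc_program (ram_input code) (77 * N ^ 4)
    (\<lambda>s. \<exists>y. ram_output s = answer_code y \<and> mpc_arc_solution inst y)"
proof -
  have "runs mpc_program (ram_input code) (19 * N\<^sup>2 + (30 * N ^ 4 + 28 * N))
    (\<lambda>s. \<exists>y. ram_output s = answer_code y \<and> mpc_arc_solution inst y)"
    unfolding mpc_program_def
    by (intro runs_Seq[OF runs_prepare] runs_Seq[OF runs_search] runs_finish)
  \<comment> \<open>All three bounds are rounded up to multiples of \<open>N ^ 4\<close>, and 19 +
    30 + 28 = 77.\<close>
  moreover have "N \<le> N ^ 4" "N\<^sup>2 \<le> N ^ 4"
    using one_le_N self_le_power[of N 4] power_increasing[of 2 4 N] by auto
  ultimately show ?thesis by (elim runs_mono) auto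
qed

end

theorem theorem2:
  shows "solvable_in_polynomial_time_on
    {(G, C). mpc_arc_instance (G, C) \<and> standard_nodes G \<and> is_path_closure G}
    mpc_arc_code answer_code mpc_arc_solution"
  unfolding solvable_in_polynomial_time_on_def
\<comment> \<open>At the input length the polynomial takes the value \<open>77 * N ^ 4\<close>,
  where \<open>N\<close> is one more than that length.\<close>
proof (rule exI[of _ mpc_program], rule exI[of _ "smult 77 ([:1, 1:] ^ 4)"], rule ballI)
  let ?p = "smult 77 ([:1, 1:] ^ 4) :: nat poly"
  fix x assume "x \<in> {(G, C). mpc_arc_instance (G, C) \<and> standard_nodes G \<and> is_path_closure G}"
  then obtain C vs where x: "x = (path_closure vs, C)" "C \<subseteq> parcs (path_closure vs)"
    and vs: "vs \<noteq> []" "distinct vs" "standard_nodes (path_closure vs)"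
    by (auto simp: mpc_arc_instance_def is_path_closure_def)
  let ?N = "Suc (length (mpc_arc_code x))"
  have nodes: "set vs = {..<length vs}"
    using vs by (simp add: standard_nodes_def path_closure_def distinct_card)
  interpret closure_instance vs C by unfold_locales (use vs x in auto)
  have "?N = Suc (Suc (length vs * length vs + length vs * length vs))"
    using vs(2) by (simp add: x mpc_arc_code_def path_closure_def distinct_card Let_def)
  then have "length vs \<le> ?N" using le_square[of "length vs"] by linarith
  then interpret standard_instance vs C ?N by unfold_locales (use nodes in auto)
  have "poly ?p (length (mpc_arc_code x)) = 77 * ?N ^ 4" by (simp add: poly_power)
  moreover obtain t s y where "ram_exec mpc_program (ram_input (mpc_arc_code x)) t s" "t \<le> 77 * ?N ^ 4"
    "ram_output s = answer_code y" "mpc_arc_solution x y"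
    using runs_mpc_program unfolding runs_def x(1) by blast
  ultimately show "\<exists>t s y. ram_exec mpc_program (ram_input (mpc_arc_code x)) t s \<and>
      t \<le> poly ?p (length (mpc_arc_code x)) \<and> ram_output s = answer_code y \<and> mpc_arc_solution x y"
    by auto
qed

end
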